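(* Let $F:\mathbb{R}^n\to\mathbb{R}\cup\{+\infty\}$ be an $\mathbb{R}$-DDM-convex function, and let $f:\mathbb{Z}^n\to\mathbb{R}\cup\{+\infty\}$ be the restriction of $F$ to $\mathbb{Z}^n$. Then for each $x^*\in\operatorname{argmin} f$ there exists $\overline{x}\in\operatorname{argmin} F$ with $\|x^*-\overline{x}\|_\infty\le n$.
   Context: For $x,y\in\mathbb{Z}^n$, the vector $\mu(x,y)\in\mathbb{Z}^n$ is defined componentwise by $\mu(x,y)_i=\lceil (x_i+y_i)/2\rceil$ if $x_i\ge y_i$, and $\mu(x,y)_i=\lfloor (x_i+y_i)/2\rfloor$ if $x_i<y_i$. A function $f:\mathbb{Z}^n\to\mathbb{R}\cup\{+\infty\}$ is called DDM-convex (directed discrete midpoint convex) if $f(x)+f(y)\ge f(\mu(x,y))+f(\mu(y,x))$ for all $x,y\in\mathbb{Z}^n$. A continuous convex function $F:\mathbb{R}^n\to\mathbb{R}\cup\{+\infty\}$ is called an $\mathbb{R}$-DDM-convex function (directed discrete midpoint convex function in continuous variables) if for every positive integer $\alpha$ the function $f^{1/\alpha}:\mathbb{Z}^n\to\mathbb{R}\cup\{+\infty\}$ defined by $f^{1/\alpha}(x)=F(x/\alpha)$ $(x\in\mathbb{Z}^n)$ is DDM-convex. In particular, the restriction of $F$ to $\mathbb{Z}^n$ is $f=f^{1/1}$. $\operatorname{argmin} f=\{x\in\mathbb{Z}^n\mid f(x)\le f(z)\ \forall z\in\mathbb{Z}^n\}$, $\operatorname{argmin} F=\{x\in\mathbb{R}^n\mid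 F(x)\le F(z)\ \forall z\in\mathbb{R}^n\}$, and $\|x\|_\infty=\max_i|x_i|$.
   Formalization: The formal theorem additionally assumes that f is not identically +∞ on Z^n; otherwise argmin f is all of Z^n and the claim fails, e.g. for n=1 and F(x)=1/x+1/(1-x) on (0,1), +∞ elsewhere. *)

theory Defs
  imports "HOL-Analysis.Analysis"
begin

text \<open>
  Functions with values in the reals extended by plus infinity are functions into \<^typ>\<open>ereal\<close>
  that never take the value \<^term>\<open>- \<infinity> :: ereal\<close>.  The dimension \<open>n\<close> is \<open>CARD('n)\<close>.
\<close>

definition mu :: "int ^ 'n \<Rightarrow> int ^ 'n \<Rightarrow> int ^ 'n" where
  "mu x y = (\<chi> i. if x $ i \<ge> y $ i
                    then \<lceil>real_of_int (x $ i + y $ i) / 2\<rceil>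
                    else \<lfloor>real_of_int (x $ i + y $ i) / 2\<rfloor>)"

definition DDM_convex :: "(int ^ 'n \<Rightarrow> ereal) \<Rightarrow> bool" where
  "DDM_convex f \<longleftrightarrow>
     (\<forall>x. f x \<noteq> - \<infinity>) \<and> (\<forall>x y. f x + f y \<ge> f (mu x y) + f (mu y x))"

text \<open>
  The library's \<^const>\<open>convex_on\<close> only covers real-valued functions.  Only \<open>0 < t < 1\<close> is used, so
  no convention for \<open>0 * \<infinity>\<close> matters.
\<close>

definition ereal_convex :: "('a::real_vector \<Rightarrow> ereal) \<Rightarrow> bool" where
  "ereal_convex F \<longleftrightarrow>
     (\<forall>x. F x \<noteq> - \<infinity>) \<and>
     (\<forall>x y. \<forall>t::real. 0 < t \<longrightarrow> t < 1 \<longrightarrow>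
        F ((1 - t) *\<^sub>R x + t *\<^sub>R y) \<le> ereal (1 - t) * F x + ereal t * F y)"

definition real_vec :: "int ^ 'n \<Rightarrow> real ^ 'n" where
  "real_vec x = (\<chi> i. real_of_int (x $ i))"

definition int_restrict :: "(real ^ 'n \<Rightarrow> ereal) \<Rightarrow> int ^ 'n \<Rightarrow> ereal" where
  "int_restrict F x = F (real_vec x)"

text \<open>\<open>int_scaled F \<alpha>\<close> is the function \<open>f\<close> with superscript \<open>1/\<alpha>\<close>.\<close>

definition int_scaled :: "(real ^ 'n \<Rightarrow> ereal) \<Rightarrow> nat \<Rightarrow> int ^ 'n \<Rightarrow> ereal" where
  "int_scaled F \<alpha> x = F (real_vec x /\<^sub>R real \<alpha>)"

lemma int_scaled_1: "int_scaled F 1 = int_restrict F"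
  by (simp add: fun_eq_iff int_scaled_def int_restrict_def)

text \<open>
  Continuity is with respect to the order topology of \<^typ>\<open>ereal\<close>, so that the effective domain
  is open and \<open>F\<close> tends to infinity at its boundary.
\<close>

definition R_DDM_convex :: "(real ^ 'n \<Rightarrow> ereal) \<Rightarrow> bool" where
  "R_DDM_convex F \<longleftrightarrow>
     continuous_on UNIV F \<and> ereal_convex F \<and> (\<forall>\<alpha>::nat. \<alpha> > 0 \<longrightarrow> DDM_convex (int_scaled F \<alpha>))"

definition argmin :: "('a \<Rightarrow> ereal) \<Rightarrow> 'a set" where
  "argmin f = {x. \<forall>z. f x \<le> f z}"

definition eff_dom :: "('a \<Rightarrow> ereal) \<Rightarrow> 'a set" where
  "eff_dom f = {x. f x < \<infinity>}"

end

theory Submission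
  imports Defs
begin

text \<open>
  Read a displacement \<open>w\<close> in \<open>\<int>\<^sup>n\<close> as a stack of levels: level \<open>k\<close> is the vector of signs
  of those \<open>w\<^sub>i\<close> with \<open>\<bar>w\<^sub>i\<bar> > k\<close>, and \<open>w\<close> is the sum of its levels.  Halving \<open>w\<close> with rounding
  towards zero keeps every second level, so directed discrete midpoint convexity compares the
  endpoints \<open>x\<close> and \<open>x + w\<close> with the two points obtained by distributing the levels of \<open>w\<close>
  alternately.  The same applies between any two partial sums of levels, and this is enough to
  make \<open>g\<close> supermodular as a function of the set of levels added to \<open>x\<close>
  (\<open>supermodular_of_splittings\<close>, \<open>DDM_convex_level_parts\<close>).

  Now let \<open>x\<close> minimize \<open>F\<close> over the integer points and let \<open>y\<close> lie on the grid of mesh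
  \<open>1/\<alpha>\<close> at distance more than \<open>n\<close> from \<open>x\<close>.  The coordinate of \<open>y - x\<close> of largest absolute value
  lies beyond all of the \<open>n\<close> intervals \<open>[j, j + 1)\<close> with \<open>j < n\<close>, so the other \<open>n - 1\<close> coordinates
  must leave one of these intervals free.  The levels of \<open>y - x\<close> inside a free interval
  are all equal, and together they form a nonzero vector \<open>d\<close> with entries in \<open>{-1, 0, 1}\<close>.
  Supermodularity yields \<open>F x + F y \<ge> F (x + d) + F (y - d)\<close>, and \<open>F x \<le> F (x + d)\<close> because
  \<open>x + d\<close> is integral; hence \<open>F (y - d) \<le> F y\<close>, and \<open>y - d\<close> is closer to \<open>x\<close>.  Repeating this
  leads to a point within distance \<open>n\<close> of \<open>x\<close> (\<open>DDM_proximity\<close>).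

  Consequently the minimum of the continuous function \<open>F\<close> over the compact box of radius \<open>n\<close>
  around \<open>x\<close> is a lower bound for \<open>F\<close> on all these grids, and by density everywhere.
\<close>

section \<open>Supermodularity from splittings\<close>

text \<open>
  One splitting of each set suffices, whichever it is.  To compare \<open>{A, B}\<close> with \<open>{\<emptyset>, A \<union> B}\<close>, cut
  \<open>A \<union> B\<close> by the given splitting \<open>{E, D}\<close> and use the inequality for smaller sets three times, along
  \<open>E\<close>, above \<open>A \<inter> E\<close>, and above \<open>B \<inter> E\<close>; in the sum all intermediate terms cancel.  With infinite
  values the cancellation is legitimate because finiteness at \<open>\<emptyset>\<close> and \<open>A \<union> B\<close> spreads through the
  same inequalities to each intermediate term.
\<close>

lemma supermodular_of_splittings:
  fixes h :: "'a set \<Rightarrow> ereal"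
  assumes ninf: "\<And>J. h J \<noteq> - \<infinity>"
    and split: "\<And>J L. finite L \<Longrightarrow> J \<inter> L = {} \<Longrightarrow> 2 \<le> card L \<Longrightarrow>
      \<exists>E D. E \<noteq> {} \<and> D \<noteq> {} \<and> E \<inter> D = {} \<and> E \<union> D = L \<and> h (J \<union> E) + h (J \<union> D) \<le> h J + h (J \<union> L)"
    and "finite A" "finite B" "A \<inter> B = {}" "J \<inter> (A \<union> B) = {}"
  shows "h (J \<union> A) + h (J \<union> B) \<le> h J + h (J \<union> (A \<union> B))"
  using assms(3-)
proof (induction "card (A \<union> B)" arbitrary: A B J rule: less_induct)
  case less
  have IH: "h (K \<union> C) + h (K \<union> D) \<le> h K + h (K \<union> (C \<union> D))"
    if "C \<union> D \<subset> A \<union> B" "C \<inter> D = {}" "K \<inter> (C \<union> D) = {}" for K C D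
    using that less.prems less.hyps[of C D K] psubset_card_mono[of "A \<union> B" "C \<union> D"]
    by (auto dest: finite_subset)
  show ?case
  proof (cases "A = {} \<or> B = {} \<or> h J + h (J \<union> (A \<union> B)) = \<infinity>")
    case True
    then show ?thesis by (auto simp: add.commute)
  next
    case False
    then have fin: "h J \<noteq> \<infinity>" "h (J \<union> (A \<union> B)) \<noteq> \<infinity>" by auto
    have "card A > 0" "card B > 0"
      using False less.prems by (auto simp: card_gt_0_iff)
    then have "2 \<le> card (A \<union> B)"
      using less.prems(1-3) by (subst card_Un_disjoint) linarith+
    then obtain E D where ED: "E \<noteq> {}" "D \<noteq> {}" "E \<inter> D = {}" "E \<union> D = A \<union> B"
      and hED: "h (J \<union> E) + h (J \<union> D) \<le> h J + h (J \<union> (A \<union> B))"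
      using split[of "A \<union> B" J] less.prems by auto
    \<comment> \<open>The step above \<open>P \<inter> E\<close> involves a smaller set only if \<open>P\<close> meets \<open>E\<close>, so \<open>P\<close> is whichever
      of \<open>A\<close> and \<open>B\<close> does.\<close>
    have main: "h (J \<union> P) + h (J \<union> Q) \<le> h J + h (J \<union> (A \<union> B))"
      if PQ: "P \<union> Q = A \<union> B" "P \<inter> Q = {}" and ne: "P \<inter> E \<noteq> {}" for P Q
    proof (cases "P = E")
      case True
      then have "Q = D" using PQ ED by blast
      with True hED show ?thesis by simp
    next
      case False
      let ?PE = "J \<union> (P \<inter> E)" and ?QE = "J \<union> (Q \<inter> E)" and ?EQ = "J \<union> (E \<union> Q)"
      have 1: "h ?PE + h ?QE \<le> h J + h (J \<union> E)"
      proof -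
        have "(P \<inter> E) \<union> (Q \<inter> E) = E" "E \<subset> A \<union> B"
          "(P \<inter> E) \<inter> (Q \<inter> E) = {}" "J \<inter> E = {}"
          using PQ ED less.prems by blast+
        then show ?thesis
          using IH[of "P \<inter> E" "Q \<inter> E" J] by metis
      qed
      have 2: "h (J \<union> P) + h ?EQ \<le> h ?PE + h (J \<union> (A \<union> B))"
      proof -
        have "(P - E) \<union> Q \<subset> A \<union> B" using PQ ne by blast
        moreover have "?PE \<union> (P - E) = J \<union> P" "?PE \<union> Q = ?EQ"
          "?PE \<union> ((P - E) \<union> Q) = J \<union> (A \<union> B)"
          using PQ ED by blast+
        moreover have "(P - E) \<inter> Q = {}" "?PE \<inter> ((P - E) \<union> Q) = {}"
          using PQ less.prems by blast+
        ultimately show ?thesis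
          using IH[of "P - E" Q ?PE] by metis
      qed
      have 3: "h (J \<union> E) + h (J \<union> Q) \<le> h ?QE + h ?EQ"
      proof -
        have "(P \<inter> E) \<union> (Q - E) \<subset> A \<union> B" using PQ ED False by blast
        moreover have "?QE \<union> (P \<inter> E) = J \<union> E" "?QE \<union> (Q - E) = J \<union> Q"
          "?QE \<union> ((P \<inter> E) \<union> (Q - E)) = ?EQ"
          using PQ ED by blast+
        moreover have "(P \<inter> E) \<inter> (Q - E) = {}" "?QE \<inter> ((P \<inter> E) \<union> (Q - E)) = {}"
          using PQ less.prems by blast+
        ultimately show ?thesis
          using IH[of "P \<inter> E" "Q - E" ?QE] by metis
      qed
      have fE: "h (J \<union> E) \<noteq> \<infinity>"
        using hED fin ninf by auto
      have fPE: "h ?PE \<noteq> \<infinity>" "h ?QE \<noteq> \<infinity>"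
        using 1 fE fin ninf by auto
      have fEQ: "h ?EQ \<noteq> \<infinity>"
        using 2 fPE fin ninf by auto
      have fQ: "h (J \<union> P) \<noteq> \<infinity>" "h (J \<union> Q) \<noteq> \<infinity>"
        using 2 3 fPE fEQ fin ninf by auto
      have real: "\<exists>r. h K = ereal r" if "h K \<noteq> \<infinity>" for K
        using that ninf[of K] by (cases "h K") auto
      obtain a b c d e p q l where "h J = ereal a" "h (J \<union> E) = ereal b" "h ?PE = ereal c"
        "h ?QE = ereal d" "h ?EQ = ereal e" "h (J \<union> P) = ereal p" "h (J \<union> Q) = ereal q"
        "h (J \<union> (A \<union> B)) = ereal l"
        using real fin fE fPE fEQ fQ by metis
      then show ?thesis using 1 2 3 by simp
    qed
    have "A \<inter> E \<noteq> {} \<or> B \<inter> E \<noteq> {}" using ED by blast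
    then show ?thesis
      using main[of A B] main[of B A] less.prems by (auto simp: Un_commute Int_commute add.commute)
  qed
qed

section \<open>Levels of an integer vector\<close>

text \<open>
  The sum of the levels of \<open>w\<close> with index in \<open>J\<close>.  Levels count from zero, so that coordinate \<open>i\<close>
  takes part in the levels below \<open>\<bar>w\<^sub>i\<bar>\<close>.
\<close>

definition level_part :: "int ^ 'n \<Rightarrow> nat set \<Rightarrow> int ^ 'n" where
  "level_part w J = (\<chi> i. sgn (w $ i) * int (card (J \<inter> {..<nat \<bar>w $ i\<bar>})))"

lemma level_part_Un:
  assumes "J \<inter> L = {}"
  shows "level_part w (J \<union> L) = level_part w J + level_part w L"
proof -
  have "card ((J \<union> L) \<inter> {..<t}) = card (J \<inter> {..<t}) + card (L \<inter> {..<t})" for t :: nat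
    using assms by (subst card_Un_disjoint[symmetric]) (auto simp: Int_Un_distrib2)
  then show ?thesis
    by (simp add: level_part_def vec_eq_iff algebra_simps)
qed

text \<open>
  Taking every second element of \<open>L\<close>, starting with its second smallest, halves all initial
  segments of \<open>L\<close> at once.  This turns the coordinatewise halving in \<^const>\<open>mu\<close> into a choice
  of levels common to all coordinates.
\<close>

lemma alternating_half:
  fixes L :: "nat set"
  defines "E \<equiv> {l \<in> L. odd (card (L \<inter> {..<l}))}"
  shows "card (E \<inter> {..<t}) = card (L \<inter> {..<t}) div 2"
proof (induction t)
  case (Suc t)
  have "S \<inter> {..<Suc t} = (if t \<in> S then insert t (S \<inter> {..<t}) else S \<inter> {..<t})" for S
    by (auto simp: less_Suc_eq)
  with Suc show ?case
    by (auto simp: E_def)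
qed simp

text \<open>
  The midpoint \<open>mu x y\<close> is always rounded towards its first argument \<open>x\<close>, so it is \<open>x\<close> plus half
  of the displacement, truncated towards zero.
\<close>

lemma mu_half_step:
  fixes x w v :: "int ^ 'n" and c :: "'n \<Rightarrow> nat"
  assumes v: "\<And>i. v $ i = sgn (w $ i) * int (c i)"
  shows "mu x (x + v) = x + (\<chi> i. sgn (w $ i) * int (c i div 2))"
    and "mu (x + v) x = x + (\<chi> i. sgn (w $ i) * int (c i - c i div 2))"
proof -
  have up: "\<lceil>real_of_int k / 2\<rceil> = - ((- k) div 2)" and down: "\<lfloor>real_of_int k / 2\<rfloor> = k div 2" for k
    using ceiling_divide_eq_div[of k 2] floor_divide_of_int_eq[of k 2] by simp_all
  show "mu x (x + v) = x + (\<chi> i. sgn (w $ i) * int (c i div 2))"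
    unfolding mu_def vec_eq_iff up down by (auto simp: v sgn_if)
  show "mu (x + v) x = x + (\<chi> i. sgn (w $ i) * int (c i - c i div 2))"
    unfolding mu_def vec_eq_iff up down by (auto simp: v sgn_if; presburger)
qed

text \<open>
  The midpoints of two partial sums of levels of \<open>w\<close> are again partial sums of levels of \<open>w\<close>:
  the levels present in both are kept, the others are dealt out alternately.  This provides
  the splittings required for supermodularity.
\<close>

lemma DDM_convex_level_parts:
  fixes g :: "int ^ 'n \<Rightarrow> ereal"
  assumes g: "DDM_convex g" and fin: "finite A" "finite B" and disj: "A \<inter> B = {}"
  shows "g (x + level_part w A) + g (x + level_part w B) \<le> g x + g (x + level_part w (A \<union> B))"
proof -
  let ?h = "\<lambda>J. g (x + level_part w J)"
  have "?h ({} \<union> A) + ?h ({} \<union> B) \<le> ?h {} + ?h ({} \<union> (A \<union> B))"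
  proof (rule supermodular_of_splittings)
    show "?h J \<noteq> - \<infinity>" for J
      using g by (simp add: DDM_convex_def)
  next
    fix J L :: "nat set"
    assume L: "finite L" and JL: "J \<inter> L = {}" and card: "2 \<le> card L"
    define E where "E = {l \<in> L. odd (card (L \<inter> {..<l}))}"
    define D where "D = L - E"
    have EL: "E \<subseteq> L" by (auto simp: E_def)
    have cE: "card (E \<inter> {..<t}) = card (L \<inter> {..<t}) div 2" for t
      unfolding E_def by (rule alternating_half)
    have cD: "card (D \<inter> {..<t}) = card (L \<inter> {..<t}) - card (L \<inter> {..<t}) div 2" for t
    proof -
      have "D \<inter> {..<t} = (L \<inter> {..<t}) - (E \<inter> {..<t})" by (auto simp: D_def)
      moreover have "E \<inter> {..<t} \<subseteq> L \<inter> {..<t}" using EL by blast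
      ultimately show ?thesis by (simp add: card_Diff_subset cE)
    qed
    obtain t where "L \<subseteq> {..<t}"
      using L finite_nat_set_iff_bounded by (metis lessThan_iff subsetI)
    then have "L \<inter> {..<t} = L" "E \<inter> {..<t} = E" "D \<inter> {..<t} = D"
      using EL by (auto simp: D_def)
    then have "card E = card L div 2" "card D = card L - card L div 2"
      using cE[of t] cD[of t] by simp_all
    then have ne: "E \<noteq> {}" "D \<noteq> {}"
      using card by auto
    let ?X = "x + level_part w J"
    have "mu ?X (?X + level_part w L) = ?X + level_part w E"
      "mu (?X + level_part w L) ?X = ?X + level_part w D"
      by (subst mu_half_step[where w = w and c = "\<lambda>i. card (L \<inter> {..<nat \<bar>w $ i\<bar>})"],
          simp add: level_part_def, simp add: level_part_def cE cD)+
    then have "g (?X + level_part w E) + g (?X + level_part w D) \<le> g ?X + g (?X + level_part w L)"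
      using g unfolding DDM_convex_def by metis
    moreover have "J \<inter> E = {}" "J \<inter> D = {}"
      using JL EL by (auto simp: D_def)
    ultimately have "?h (J \<union> E) + ?h (J \<union> D) \<le> ?h J + ?h (J \<union> L)"
      using JL by (simp add: level_part_Un add.assoc)
    then show "\<exists>E D. E \<noteq> {} \<and> D \<noteq> {} \<and> E \<inter> D = {} \<and> E \<union> D = L \<and>
        ?h (J \<union> E) + ?h (J \<union> D) \<le> ?h J + ?h (J \<union> L)"
      using ne EL by (intro exI[of _ E] exI[of _ D]) (auto simp: D_def)
  qed (use fin disj in auto)
  moreover have "level_part w {} = 0"
    by (simp add: level_part_def vec_eq_iff)
  ultimately show ?thesis by simp
qed

text \<open>
  No coordinate ends inside the band, so each of them crosses either all \<open>\<alpha>\<close> levels of it or none.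
\<close>

lemma level_part_band:
  fixes w :: "int ^ 'n" and \<alpha> j :: nat
  assumes free: "\<And>i. nat \<bar>w $ i\<bar> div \<alpha> \<noteq> j" and pos: "\<alpha> > 0"
  shows "level_part w {j * \<alpha> ..< Suc j * \<alpha>} $ i =
      int \<alpha> * (if Suc j * \<alpha> \<le> nat \<bar>w $ i\<bar> then sgn (w $ i) else 0)"
proof -
  let ?t = "nat \<bar>w $ i\<bar>"
  consider "?t div \<alpha> < j" | "Suc j \<le> ?t div \<alpha>"
    using free[of i] by linarith
  then show ?thesis
  proof cases
    case 1
    then have "?t < j * \<alpha>" using pos by (simp add: div_less_iff_less_mult)
    then have "{j * \<alpha> ..< Suc j * \<alpha>} \<inter> {..<?t} = {}" "\<not> Suc j * \<alpha> \<le> ?t" by auto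
    then show ?thesis by (simp only: level_part_def) simp
  next
    case 2
    then have "Suc j * \<alpha> \<le> ?t" using pos less_eq_div_iff_mult_less_eq by blast
    then have "{j * \<alpha> ..< Suc j * \<alpha>} \<inter> {..<?t} = {j * \<alpha> ..< Suc j * \<alpha>}" by auto
    then show ?thesis using \<open>Suc j * \<alpha> \<le> ?t\<close> by (simp only: level_part_def) simp
  qed
qed

lemma level_part_all:
  assumes "\<And>i. nat \<bar>w $ i\<bar> \<le> N"
  shows "level_part w {..<N} = w"
proof -
  have "{..<N} \<inter> {..<nat \<bar>w $ i\<bar>} = {..<nat \<bar>w $ i\<bar>}" for i
    using assms[of i] by auto
  then show ?thesis
    by (simp add: level_part_def vec_eq_iff sgn_mult_abs)
qed

section \<open>Proximity on the grids\<close>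

text \<open>
  On the grid of mesh \<open>1/\<alpha>\<close> the unit steps of the original lattice are steps of length \<open>\<alpha>\<close>, and
  \<open>x\<close> is only known to be optimal with respect to these.  Removing from \<open>y - x\<close> a band of \<open>\<alpha>\<close> equal
  levels is such a step, and it does not increase \<open>g\<close>; the induction is on the \<open>\<ell>\<^sub>1\<close> distance of \<open>y\<close>
  from \<open>x\<close>.
\<close>

lemma DDM_proximity:
  fixes g :: "int ^ 'n \<Rightarrow> ereal" and x y :: "int ^ 'n" and \<alpha> :: nat
  assumes g: "DDM_convex g" and pos: "\<alpha> > 0" and fin: "g x \<noteq> \<infinity>"
    and min: "\<And>d :: int ^ 'n. (\<forall>i. d $ i \<in> {- 1, 0, 1}) \<Longrightarrow> g x \<le> g (x + (\<chi> i. int \<alpha> * d $ i))"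
  shows "\<exists>z. (\<forall>i. \<bar>z $ i - x $ i\<bar> \<le> int (CARD('n) * \<alpha>)) \<and> g z \<le> g y"
proof (induction "\<Sum>i\<in>UNIV. nat \<bar>y $ i - x $ i\<bar>" arbitrary: y rule: less_induct)
  case less
  define w where "w = y - x"
  show ?case
  proof (cases "\<forall>i. \<bar>w $ i\<bar> \<le> int (CARD('n) * \<alpha>)")
    case True
    then show ?thesis by (intro exI[of _ y]) (simp add: w_def)
  next
    case False
    then obtain m where m: "CARD('n) * \<alpha> < nat \<bar>w $ m\<bar>" by (auto simp: not_le zless_nat_eq_int_zless)
    let ?b = "\<lambda>i. nat \<bar>w $ i\<bar> div \<alpha>"
    \<comment> \<open>Block \<open>?b m\<close> lies beyond the first \<open>n\<close> blocks, so at most \<open>n - 1\<close> of those are occupied.\<close>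
    obtain j where j: "j < CARD('n)" "j \<notin> range ?b"
    proof -
      have "?b m \<ge> CARD('n)" using m pos by (simp add: less_eq_div_iff_mult_less_eq)
      then have "insert (?b m) {..<CARD('n)} \<subseteq> range ?b" if "{..<CARD('n)} \<subseteq> range ?b"
        using that by auto
      moreover have "card (insert (?b m) {..<CARD('n)}) = Suc (CARD('n))"
        using \<open>?b m \<ge> CARD('n)\<close> by simp
      moreover have "card (range ?b) \<le> CARD('n)" by (rule card_image_le) simp
      ultimately have "\<not> {..<CARD('n)} \<subseteq> range ?b"
        using card_mono[of "range ?b" "insert (?b m) {..<CARD('n)}"] by auto
      then show thesis using that by auto
    qed
    define d :: "int ^ 'n" where "d = (\<chi> i. if Suc j * \<alpha> \<le> nat \<bar>w $ i\<bar> then sgn (w $ i) else 0)"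
    define u :: "int ^ 'n" where "u = (\<chi> i. int \<alpha> * d $ i)"
    define band where "band = {j * \<alpha> ..< Suc j * \<alpha>}"
    have u: "level_part w band = u"
    proof -
      have "nat \<bar>w $ i\<bar> div \<alpha> \<noteq> j" for i using j(2) by blast
      then show ?thesis
        unfolding vec_eq_iff band_def u_def d_def vec_lambda_beta using pos
        by (intro allI level_part_band)
    qed
    \<comment> \<open>Any bound on the coordinates of \<open>w\<close> that also lies above the band would do.\<close>
    define N where "N = Suc j * \<alpha> + (\<Sum>i\<in>UNIV. nat \<bar>w $ i\<bar>)"
    have N: "nat \<bar>w $ i\<bar> \<le> N" for i
      unfolding N_def by (rule trans_le_add2, rule member_le_sum) auto
    have "band \<subseteq> {..<N}" by (auto simp: band_def N_def)
    then have Un: "band \<union> ({..<N} - band) = {..<N}" by auto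
    then have "u + level_part w ({..<N} - band) = w"
      using level_part_Un[of band "{..<N} - band" w] N by (simp add: level_part_all u)
    then have rest: "level_part w ({..<N} - band) = w - u" by (simp add: algebra_simps)
    have "g (x + u) + g (x + (w - u)) \<le> g x + g (x + w)"
      using DDM_convex_level_parts[OF g, of band "{..<N} - band" x w] level_part_all[OF N]
      unfolding Un u rest by (simp add: band_def)
    then have 1: "g (x + u) + g (y - u) \<le> g x + g y"
      by (simp add: w_def algebra_simps)
    have "g x \<le> g (x + u)"
      unfolding u_def by (rule min) (auto simp: d_def sgn_if)
    moreover have "g x \<noteq> - \<infinity>" using g by (simp add: DDM_convex_def)
    ultimately have "g (y - u) \<le> g y"
      using 1 fin by (cases "g x"; cases "g (x + u)"; cases "g (y - u)"; cases "g y") auto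
    moreover have "(\<Sum>i\<in>UNIV. nat \<bar>(y - u) $ i - x $ i\<bar>) < (\<Sum>i\<in>UNIV. nat \<bar>y $ i - x $ i\<bar>)"
    proof (rule sum_strict_mono_ex1)
      have eq: "(y - u) $ i - x $ i = w $ i - u $ i" "y $ i - x $ i = w $ i" for i
        by (auto simp: w_def)
      have "\<bar>w $ i - u $ i\<bar> \<le> \<bar>w $ i\<bar>" for i
      proof (cases "Suc j * \<alpha> \<le> nat \<bar>w $ i\<bar>")
        case True
        then have "int \<alpha> \<le> \<bar>w $ i\<bar>" by auto
        then show ?thesis by (auto simp: u_def d_def sgn_if)
      qed (simp add: u_def d_def)
      then show "\<forall>i\<in>UNIV. nat \<bar>(y - u) $ i - x $ i\<bar> \<le> nat \<bar>y $ i - x $ i\<bar>"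
        unfolding eq by (simp add: nat_mono)
      have "Suc j * \<alpha> \<le> CARD('n) * \<alpha>" using j by (intro mult_right_mono) auto
      then have le: "Suc j * \<alpha> \<le> nat \<bar>w $ m\<bar>" using m by linarith
      then have "int \<alpha> \<le> \<bar>w $ m\<bar>" by auto
      then have "\<bar>w $ m - u $ m\<bar> < \<bar>w $ m\<bar>"
        using pos le by (auto simp: u_def d_def sgn_if)
      then show "\<exists>i\<in>UNIV. nat \<bar>(y - u) $ i - x $ i\<bar> < nat \<bar>y $ i - x $ i\<bar>"
        unfolding eq by (intro bexI[of _ m]) auto
    qed simp
    ultimately show ?thesis
      using less.hyps[of "y - u"] by (meson order_trans)
  qed
qed

lemma R_DDM_grid_proximity:
  fixes F :: "real ^ 'n \<Rightarrow> ereal"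
  assumes F: "R_DDM_convex F" and x: "x \<in> argmin (int_restrict F)" and fin: "F (real_vec x) \<noteq> \<infinity>"
    and pos: "\<alpha> > 0"
  shows "\<exists>z. infnorm (real_vec x - z) \<le> real CARD('n) \<and> F z \<le> int_scaled F \<alpha> y"
proof -
  let ?g = "int_scaled F \<alpha>"
  let ?x = "\<chi> i. int \<alpha> * x $ i"
  have gx: "?g (?x + (\<chi> i. int \<alpha> * d $ i)) = F (real_vec (x + d))" for d
    using pos by (auto simp: int_scaled_def real_vec_def vec_eq_iff field_simps intro!: arg_cong[of _ _ F])
  have "?g ?x = F (real_vec x)"
    using pos by (auto simp: int_scaled_def real_vec_def vec_eq_iff intro!: arg_cong[of _ _ F])
  then obtain z where z: "\<And>i. \<bar>z $ i - ?x $ i\<bar> \<le> int (CARD('n) * \<alpha>)" "?g z \<le> ?g y"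
    using DDM_proximity[of ?g \<alpha> ?x y] F x fin pos gx
    by (auto simp: R_DDM_convex_def argmin_def int_restrict_def)
  have "infnorm (real_vec x - real_vec z /\<^sub>R real \<alpha>) \<le> real CARD('n)"
    unfolding infnorm_Max
  proof (rule Max.boundedI)
    fix a assume "a \<in> (\<lambda>b. \<bar>(real_vec x - real_vec z /\<^sub>R real \<alpha>) \<bullet> b\<bar>) ` Basis"
    then obtain i where a: "a = \<bar>real_of_int (x $ i) - real_of_int (z $ i) / real \<alpha>\<bar>"
      by (auto simp: Basis_vec_def inner_axis real_vec_def divide_inverse mult.commute)
    have "\<bar>real_of_int (z $ i - int \<alpha> * x $ i)\<bar> \<le> real CARD('n) * real \<alpha>"
    proof -
      have "real_of_int \<bar>z $ i - int \<alpha> * x $ i\<bar> \<le> real_of_int (int (CARD('n) * \<alpha>))"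
        using z(1)[of i] unfolding of_int_le_iff by simp
      then show ?thesis by simp
    qed
    moreover have "a * real \<alpha> = \<bar>real_of_int (z $ i - int \<alpha> * x $ i)\<bar>"
    proof -
      have "a * real \<alpha> = \<bar>(real_of_int (x $ i) - real_of_int (z $ i) / real \<alpha>) * real \<alpha>\<bar>"
        by (simp add: a abs_mult)
      also have "(real_of_int (x $ i) - real_of_int (z $ i) / real \<alpha>) * real \<alpha>
          = real_of_int (int \<alpha> * x $ i - z $ i)"
        using pos by (simp add: left_diff_distrib)
      finally show ?thesis by linarith
    qed
    ultimately have "a * real \<alpha> \<le> real CARD('n) * real \<alpha>" by linarith
    then show "a \<le> real CARD('n)" using pos by simp
  qed auto
  with z(2) show ?thesis by (auto simp: int_scaled_def)
qed

section \<open>Passage to the continuous minimizer\<close>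

theorem theorem9p1:
  fixes F :: "real ^ 'n \<Rightarrow> ereal" and f :: "int ^ 'n \<Rightarrow> ereal"
  assumes "R_DDM_convex F"
    and "f = int_restrict F"
    and "eff_dom f \<noteq> {}"
  shows "\<forall>x \<in> argmin f. \<exists>xbar \<in> argmin F. infnorm (real_vec x - xbar) \<le> real CARD('n)"
proof
  fix x assume x: "x \<in> argmin f"
  have cont: "continuous_on UNIV F" using assms by (simp add: R_DDM_convex_def)
  have fin: "F (real_vec x) \<noteq> \<infinity>"
    using x assms(2,3) by (fastforce simp: argmin_def eff_dom_def int_restrict_def)
  let ?S = "{z. infnorm (real_vec x - z) \<le> real CARD('n)}"
  have "compact ?S"
  proof -
    have "closed ?S"
      by (intro closed_Collect_le continuous_intros continuous_on_infnorm)
    moreover have "bounded ?S"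
    proof (rule bounded_subset[OF bounded_cball])
      show "?S \<subseteq> cball (real_vec x) (sqrt (DIM(real ^ 'n)) * real CARD('n))"
      proof
        fix z assume "z \<in> ?S"
        then show "z \<in> cball (real_vec x) (sqrt (DIM(real ^ 'n)) * real CARD('n))"
          using norm_le_infnorm[of "real_vec x - z"]
          by (auto simp: dist_norm intro: order_trans mult_left_mono)
      qed
    qed
    ultimately show ?thesis by (simp add: compact_eq_bounded_closed)
  qed
  moreover have "real_vec x \<in> ?S" by (simp add: infnorm_0)
  ultimately obtain xbar where xbar: "xbar \<in> ?S" "\<And>z. z \<in> ?S \<Longrightarrow> F xbar \<le> F z"
    using continuous_attains_inf[of ?S F] continuous_on_subset[OF cont, of ?S] by blast
  have "F xbar \<le> F y" for y
  proof -
    define q :: "nat \<Rightarrow> int ^ 'n" where "q k = (\<chi> i. \<lfloor>real (Suc k) * y $ i\<rfloor>)" for k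
    have "(\<lambda>k. real_vec (q k) /\<^sub>R real (Suc k)) \<longlonglongrightarrow> y"
    proof (rule vec_tendstoI)
      fix i
      have "(\<lambda>k. real_of_int \<lfloor>real (Suc k) * y $ i\<rfloor> / real (Suc k)) \<longlonglongrightarrow> y $ i"
      proof (rule real_tendsto_sandwich)
        show "\<forall>\<^sub>F k in sequentially. y $ i - 1 / real (Suc k) \<le> real_of_int \<lfloor>real (Suc k) * y $ i\<rfloor> / real (Suc k)"
        proof (intro always_eventually allI)
          fix k
          have "y $ i - 1 / real (Suc k) = (real (Suc k) * y $ i - 1) / real (Suc k)"
            by (simp add: diff_divide_distrib del: of_nat_Suc)
          also have "\<dots> \<le> real_of_int \<lfloor>real (Suc k) * y $ i\<rfloor> / real (Suc k)"
            by (intro divide_right_mono) linarith+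
          finally show "y $ i - 1 / real (Suc k) \<le> real_of_int \<lfloor>real (Suc k) * y $ i\<rfloor> / real (Suc k)" .
        qed
        show "\<forall>\<^sub>F k in sequentially. real_of_int \<lfloor>real (Suc k) * y $ i\<rfloor> / real (Suc k) \<le> y $ i"
          by (intro always_eventually allI) (simp add: divide_le_eq mult.commute del: of_nat_Suc)
        show "(\<lambda>k. y $ i - 1 / real (Suc k)) \<longlonglongrightarrow> y $ i"
          using tendsto_diff[OF tendsto_const LIMSEQ_inverse_real_of_nat, of "y $ i"]
          by (simp add: inverse_eq_divide)
      qed simp
      then show "(\<lambda>k. (real_vec (q k) /\<^sub>R real (Suc k)) $ i) \<longlonglongrightarrow> y $ i"
        by (simp add: real_vec_def q_def divide_inverse mult.commute del: of_nat_Suc)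
    qed
    then have "(\<lambda>k. int_scaled F (Suc k) (q k)) \<longlonglongrightarrow> F y"
      using continuous_on_tendsto_compose[OF cont] by (simp add: int_scaled_def del: of_nat_Suc)
    moreover have "F xbar \<le> int_scaled F (Suc k) (q k)" for k
      using R_DDM_grid_proximity[of F x "Suc k" "q k"] assms x fin xbar(2) by (force intro: order_trans)
    ultimately show ?thesis
      using LIMSEQ_le_const by blast
  qed
  with xbar(1) show "\<exists>xbar \<in> argmin F. infnorm (real_vec x - xbar) \<le> real CARD('n)"
    by (auto simp: argmin_def)
qed

end
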